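(* For every integer $n\ge0$, the third order Padé approximant ${}_{[1|2]}E_n\!\left(x;\frac16,\frac1{12}\right)$ of the Euler polynomial has the umbral representation $$ {}_{[1|2]}E_n\!\left(x;\tfrac16,\tfrac1{12}\right)=e_n(x,\hat u)\varphi_0-\frac n3\,e_{n-1}(x,\hat u)\varphi_0, \qquad\text{where}\quad \hat u^r\varphi_0=U_r\!\left(\tfrac16,\tfrac1{12}\right)\ (r\ge0). $$
   Context: Padé approximants: for a function $f$ with Maclaurin series at $0$, the Padé approximant ${}_{[p|q]}f(t)=\frac{\sum_{j=0}^{p}a_jt^j}{\sum_{j=0}^{q}b_jt^j}$, normalized by $b_0=1$, is the rational function whose derivatives at $0$ of orders $k=0,1,\dots,p+q$ agree with those of $f$; its order is $p+q$. The Euler polynomials $E_n(x)$ are the Appell polynomials with amplitude $A(t)=\frac{2}{e^t+1}$, i.e. $\sum_{n\ge0}\frac{t^n}{n!}E_n(x)=\frac{2}{e^t+1}e^{xt}$, $|t|<\pi$. Their $[1|2]$ Padé approximant, denoted ${}_{[1|2]}E_n(x)$ or ${}_{[1|2]}E_n(x;\frac16,\frac1{12})$, is the polynomial defined by $\sum_{n\ge0}\frac{t^n}{n!}\,{}_{[1|2]}E_n(x)={}_{[1|2]}A(t)\,e^{xt}$ or, equivalently, by ${}_{[1|2]}E_n(x)={}_{[1|2]}A(\partial_x)\{x^n\}$. The parameters $\frac16,\frac1{12}$ merely record the coefficients of $t$ and $t^2$ in the denominator of ${}_{[1|2]}A(t)$. Here $\partial_x=d/dx$, and a rational function of $\partial_x$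 that is regular at $0$ acts on polynomials through its Maclaurin series. First order two-variable truncated exponential polynomials: $e_n(x,y)=n!\sum_{r=0}^n\frac{x^{n-r}y^r}{(n-r)!}$ for $n\ge0$; for $n=0$ the term $\frac n3e_{n-1}$ is zero. Two-variable Chebyshev polynomials of the second kind: $U_r(a,b)$ is defined by $\frac{1}{1+at+bt^2}=\sum_{r\ge0}U_r(a,b)t^r$. Umbral notation: $\hat u$ is a formal symbol; for a polynomial $p(x,\hat u)$ in $\hat u$, $p(x,\hat u)\varphi_0$ is obtained by applying, linearly over polynomials in $x$, the rule $\hat u^r\mapsto\hat u^r\varphi_0$, with the values of $\hat u^r\varphi_0$ as prescribed. Thus $e_n(x,\hat u)\varphi_0=n!\sum_{r=0}^n\frac{x^{n-r}}{(n-r)!}U_r(\frac16,\frac1{12})$. *)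

theory Defs
  imports "HOL-Complex_Analysis.Complex_Analysis"
begin

definition is_pade_approximant ::
  "nat \<Rightarrow> nat \<Rightarrow> (complex \<Rightarrow> complex) \<Rightarrow> (complex \<Rightarrow> complex) \<Rightarrow> bool" where
  "is_pade_approximant p q f r \<longleftrightarrow>
     (\<exists>P Q :: complex poly. degree P \<le> p \<and> degree Q \<le> q \<and> coeff Q 0 = 1 \<and>
        r = (\<lambda>t. poly P t / poly Q t) \<and>
        (\<forall>k\<le>p + q. (deriv ^^ k) r 0 = (deriv ^^ k) f 0))"

(* If P1/Q1 and P2/Q2 both qualify, then P1 Q2 - P2 Q1 has degree at most p + q and a zero of
   order greater than p + q at 0, so it vanishes: the rational function is unique. The two
   representing functions can differ only at common zeros of numerator and denominator, which
   stay away from 0 because Q(0) = 1; this is why the choice below uses SOME and not THE. *)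
definition pade :: "nat \<Rightarrow> nat \<Rightarrow> (complex \<Rightarrow> complex) \<Rightarrow> complex \<Rightarrow> complex" where
  "pade p q f = (SOME r. is_pade_approximant p q f r)"

(* f(d/dx) S, with f replaced by its Maclaurin series. The sum stops at degree S because all
   higher derivatives of S vanish. *)
definition diff_op :: "(complex \<Rightarrow> complex) \<Rightarrow> complex poly \<Rightarrow> complex poly" where
  "diff_op f S = (\<Sum>k\<le>degree S. smult (fps_nth (fps_expansion f 0) k) ((pderiv ^^ k) S))"

definition euler_amplitude :: "complex \<Rightarrow> complex" where
  "euler_amplitude t = 2 / (exp t + 1)"

definition pade_euler_poly :: "nat \<Rightarrow> nat \<Rightarrow> nat \<Rightarrow> complex poly" where
  "pade_euler_poly p q n = diff_op (pade p q euler_amplitude) (monom 1 n)"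

(* e_n(x, y) as a polynomial in y whose coefficients are polynomials in x. *)
definition trunc_exp_poly :: "nat \<Rightarrow> complex poly poly" where
  "trunc_exp_poly n =
     (\<Sum>r\<le>n. monom (monom (fact n / fact (n - r)) (n - r)) r)"

definition chebyshev_U :: "complex \<Rightarrow> complex \<Rightarrow> nat \<Rightarrow> complex" where
  "chebyshev_U a b r = fps_nth (1 / (1 + fps_const a * fps_X + fps_const b * fps_X ^ 2)) r"

(* p(x, u) phi_0: the outer variable of p is the umbral symbol u, and u^r phi_0 = \<phi> r. *)
definition umbral :: "(nat \<Rightarrow> complex) \<Rightarrow> complex poly poly \<Rightarrow> complex poly" where
  "umbral \<phi> p = (\<Sum>r\<le>degree p. smult (\<phi> r) (coeff p r))"

end

theory Submission
  imports Defs
begin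

unbundle no vec_syntax

text \<open>
  The Euler amplitude is \<open>1 - t/2 + t^3/24 + O(t^4)\<close>, and matching these four coefficients forces
  its \<open>[1|2]\<close> approximant to be \<open>(1 - t/3) / (1 + t/6 + t^2/12)\<close>. Its Maclaurin coefficients
  are therefore \<open>U\<^sub>k - U\<^sub>k\<^sub>-\<^sub>1/3\<close>; applied to \<open>x^n\<close>, the \<open>U\<^sub>k\<close> give the first umbral term, and the
  shift by one derivative turns \<open>U\<^sub>k\<^sub>-\<^sub>1\<close> into the second, since \<open>d/dx x^n = n x^(n-1)\<close>.
\<close>

lemma has_fps_expansion_poly:
  fixes P :: "'a :: {banach, real_normed_div_algebra, comm_ring_1} poly"
  shows "poly P has_fps_expansion fps_of_poly P"
proof -
  have "eval_fps (fps_of_poly P) has_fps_expansion fps_of_poly P"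
    by (rule eval_fps_has_fps_expansion) simp
  then show ?thesis
    by (simp add: eval_fps_of_poly[abs_def])
qed

lemma has_fps_expansion_poly_quotient:
  fixes P Q :: "complex poly"
  assumes "coeff Q 0 \<noteq> 0"
  shows "(\<lambda>t. poly P t / poly Q t) has_fps_expansion fps_of_poly P / fps_of_poly Q"
  using assms by (intro has_fps_expansion_divide' has_fps_expansion_poly) simp

lemma fps_expansion_eqI:
  fixes f :: "complex \<Rightarrow> complex"
  assumes "f has_fps_expansion F"
  shows "fps_expansion f 0 = F"
  using fps_nth_fps_expansion[OF assms] by (simp add: fps_eq_iff fps_expansion_def)

lemma fps_divide_times_unit:
  fixes f g :: "'a :: field fps"
  assumes "g $ 0 \<noteq> 0"
  shows "f / g * g = f"
  using assms by (simp add: fps_divide_unit mult.assoc inverse_mult_eq_1)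

lemma fps_mult_nth_2: "(f * g) $ 2 = f $ 0 * g $ 2 + f $ 1 * g $ 1 + f $ 2 * g $ 0"
  by (simp add: fps_mult_nth numeral_2_eq_2)

lemma fps_mult_nth_3:
  "(f * g) $ 3 = f $ 0 * g $ 3 + f $ 1 * g $ 2 + f $ 2 * g $ 1 + f $ 3 * g $ 0"
  by (simp add: fps_mult_nth eval_nat_numeral)

lemma le_3_cases: "(\<forall>k\<le>3. P k) \<longleftrightarrow> P 0 \<and> P 1 \<and> P 2 \<and> P (3::nat)"
  by (auto simp: le_Suc_eq eval_nat_numeral)

text \<open>Comparing coefficients in \<open>E * (fps_exp 1 + 1) = 2\<close> determines those of
  \<open>E\<close> one after another, since \<open>fps_exp 1 + 1\<close> has constant term
  2.\<close>

lemma euler_amplitude_coeffs: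
  obtains E where "euler_amplitude has_fps_expansion E"
    "E $ 0 = 1" "E $ 1 = -1/2" "E $ 2 = 0" "E $ 3 = 1/24"
proof
  define E :: "complex fps" where "E = 2 / (fps_exp 1 + 1)"
  have "(\<lambda>t. 2 / (exp (1 * t) + 1)) has_fps_expansion E"
    unfolding E_def by (intro fps_expansion_intros) auto
  then show "euler_amplitude has_fps_expansion E"
    by (simp add: euler_amplitude_def[abs_def])
  have E: "E * (fps_exp 1 + 1) = 2"
    unfolding E_def by (rule fps_divide_times_unit) auto
  show e0: "E $ 0 = 1"
    using arg_cong[OF E, of "\<lambda>f. f $ 0"] by simp
  show e1: "E $ 1 = -1/2"
    using arg_cong[OF E, of "\<lambda>f. f $ 1"] e0
    by (simp add: fps_mult_nth_1 fps_numeral_nth field_simps eq_neg_iff_add_eq_0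
        del: One_nat_def divide_minus_left)
  show e2: "E $ 2 = 0"
    using arg_cong[OF E, of "\<lambda>f. f $ 2"] e0 e1
    by (simp add: fps_mult_nth_2 fps_numeral_nth fact_numeral)
  show "E $ 3 = 1/24"
    using arg_cong[OF E, of "\<lambda>f. f $ 3"]
    by (simp add: fps_mult_nth_3 fps_numeral_nth fact_numeral e0 e1 e2 eq_divide_eq mult.commute
        del: One_nat_def)
qed

text \<open>The k-th derivative at 0 is k! times the k-th Maclaurin coefficient, and
  \<open>coeff Q 0 = 1\<close> makes \<open>fps_of_poly Q\<close> a unit. The analytic condition
  thus becomes algebra of power series.\<close>

lemma is_pade_approximant_iff_fps:
  assumes "f has_fps_expansion F"
  shows "is_pade_approximant p q f r \<longleftrightarrow>
    (\<exists>P Q. degree P \<le> p \<and> degree Q \<le> q \<and> coeff Q 0 = 1 \<and>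
      r = (\<lambda>t. poly P t / poly Q t) \<and>
      (\<forall>k\<le>p + q. (fps_of_poly P / fps_of_poly Q) $ k = F $ k))"
proof -
  have "(deriv ^^ k) (\<lambda>t. poly P t / poly Q t) 0 = (deriv ^^ k) f 0 \<longleftrightarrow>
        (fps_of_poly P / fps_of_poly Q) $ k = F $ k"
    if "coeff Q 0 = 1" for P Q :: "complex poly" and k
    using that fps_nth_fps_expansion[OF assms, of k]
      fps_nth_fps_expansion[OF has_fps_expansion_poly_quotient[of Q P], of k]
    by simp
  then show ?thesis
    unfolding is_pade_approximant_def by (intro ex_cong1) auto
qed

abbreviation euler_pade_num :: "complex poly" where
  "euler_pade_num \<equiv> [:1, -(1/3):]"

abbreviation euler_pade_den :: "complex poly" where
  "euler_pade_den \<equiv> [:1, 1/6, 1/12:]"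

text \<open>Existence of an approximant: without it the \<open>SOME\<close> in \<open>pade\<close>
  would say nothing about the chosen function.\<close>

lemma is_pade_approximant_euler:
  "is_pade_approximant 1 2 euler_amplitude (\<lambda>t. poly euler_pade_num t / poly euler_pade_den t)"
proof -
  obtain E where E: "euler_amplitude has_fps_expansion E"
    "E $ 0 = 1" "E $ 1 = -1/2" "E $ 2 = 0" "E $ 3 = 1/24"
    by (rule euler_amplitude_coeffs)
  define R where "R = fps_of_poly euler_pade_num / fps_of_poly euler_pade_den"
  have R: "R * fps_of_poly euler_pade_den = fps_of_poly euler_pade_num"
    unfolding R_def by (rule fps_divide_times_unit) auto
  have coeffs: "coeff euler_pade_den 1 = 1/6" "coeff euler_pade_den 2 = 1/12" "coeff euler_pade_den 3 = 0"
    "coeff euler_pade_num 1 = -1/3" "coeff euler_pade_num 2 = 0" "coeff euler_pade_num 3 = 0"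
    by (simp_all add: coeff_pCons eval_nat_numeral)
  have r0: "R $ 0 = 1"
    using arg_cong[OF R, of "\<lambda>f. f $ 0"] by simp
  have "R $ 1 + 1/6 = -1/3"
    using arg_cong[OF R, of "\<lambda>f. f $ 1"] r0 by (simp add: add.commute)
  from add_implies_diff[OF this] have r1: "R $ 1 = -1/2"
    by simp
  have r2: "R $ 2 = 0"
    using arg_cong[OF R, of "\<lambda>f. f $ 2"] r0 r1
    by (simp add: fps_mult_nth_2 coeffs del: One_nat_def)
  have r3: "R $ 3 = 1/24"
    using arg_cong[OF R, of "\<lambda>f. f $ 3"]
    by (simp add: fps_mult_nth_3 coeffs r0 r1 r2 eq_divide_eq mult.commute del: One_nat_def)
  have "\<forall>k\<le>3. R $ k = E $ k"
    unfolding le_3_cases E r0 r1 r2 r3 by blast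
  then show ?thesis
    unfolding is_pade_approximant_iff_fps[OF E(1)] R_def
    by (intro exI[of _ euler_pade_num] exI[of _ euler_pade_den]) simp
qed

text \<open>Uniqueness at the level of Maclaurin series, which is all that \<open>diff_op\<close>
  sees; hence the choice made by \<open>SOME\<close> does not matter.\<close>

lemma is_pade_approximant_euler_fps:
  assumes "is_pade_approximant 1 2 euler_amplitude r"
  shows "fps_expansion r 0 = fps_of_poly euler_pade_num / fps_of_poly euler_pade_den"
proof -
  obtain E where E: "euler_amplitude has_fps_expansion E"
    "E $ 0 = 1" "E $ 1 = -1/2" "E $ 2 = 0" "E $ 3 = 1/24"
    by (rule euler_amplitude_coeffs)
  obtain P Q where PQ: "degree P \<le> 1" "degree Q \<le> 2" "coeff Q 0 = 1"
    "r = (\<lambda>t. poly P t / poly Q t)"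
    "\<forall>k\<le>3. (fps_of_poly P / fps_of_poly Q) $ k = E $ k"
    using assms unfolding is_pade_approximant_iff_fps[OF E(1)] by auto
  define R where "R = fps_of_poly P / fps_of_poly Q"
  have R: "R * fps_of_poly Q = fps_of_poly P"
    unfolding R_def using PQ by (intro fps_divide_times_unit) auto
  have r: "R $ 0 = 1" "R $ 1 = -1/2" "R $ 2 = 0" "R $ 3 = 1/24"
    using PQ(5) E unfolding le_3_cases R_def by auto
  have hi: "coeff Q 3 = 0" "coeff P 2 = 0" "coeff P 3 = 0"
    using PQ by (auto intro!: coeff_eq_0)
  \<comment> \<open>\<open>P\<close> has no terms in t^2 and t^3, so these two coefficients of
    \<open>R * Q = P\<close> are linear equations in \<open>Q\<close> alone:
    \<open>q2 - q1/2 = 0\<close> and \<open>-q2/2 + 1/24 = 0\<close>. The two lower coefficients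
    then yield \<open>P\<close>.\<close>
  have q2: "coeff Q 2 = coeff Q 1 / 2"
    using arg_cong[OF R, of "\<lambda>f. f $ 2"] r hi PQ(3) by (simp add: fps_mult_nth_2)
  have q2': "coeff Q 2 = 1 / 12"
    using arg_cong[OF R, of "\<lambda>f. f $ 3"] hi PQ(3)
    by (simp add: fps_mult_nth_3 r del: One_nat_def)
  have q1: "coeff Q 1 = 1/6"
    using q2 q2' by simp
  have p0: "coeff P 0 = 1"
    using arg_cong[OF R, of "\<lambda>f. f $ 0"] r PQ(3) by simp
  have "coeff P 1 = coeff Q 1 - 1/2"
    using arg_cong[OF R, of "\<lambda>f. f $ 1"] r PQ(3) by simp
  then have p1: "coeff P 1 = -1/3"
    using q1 by (simp del: One_nat_def)
  have "P = euler_pade_num"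
    using PQ(1) p0 p1
    by (intro poly_eqI) (auto simp: coeff_pCons coeff_eq_0 split: nat.splits)
  moreover have "Q = euler_pade_den"
    using PQ(2,3) q1 q2'
    by (intro poly_eqI)
       (auto simp: coeff_pCons coeff_eq_0 numeral_2_eq_2 split: nat.splits)
  ultimately show ?thesis
    using has_fps_expansion_poly_quotient[of Q P] PQ(4) by (auto intro: fps_expansion_eqI)
qed

text \<open>With D the denominator, (1 - t/3)/D = 1/D - (t/3)(1/D), and 1/D generates the
  \<open>chebyshev_U\<close> values. The factor t shifts the index, so the second term is absent at
  \<open>k = 0\<close>.\<close>

lemma fps_expansion_pade_euler_nth:
  "fps_expansion (pade 1 2 euler_amplitude) 0 $ k =
     chebyshev_U (1/6) (1/12) k - (if k = 0 then 0 else chebyshev_U (1/6) (1/12) (k - 1) / 3)"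
proof -
  have den: "fps_of_poly euler_pade_den = 1 + fps_const (1/6) * fps_X + fps_const (1/12) * fps_X ^ 2"
    by (simp add: fps_of_poly_pCons power2_eq_square algebra_simps)
  have num: "fps_of_poly euler_pade_num = 1 - fps_const (1/3) * fps_X"
    by (rule fps_ext) (auto simp: coeff_pCons split: nat.splits)
  have *: "is_pade_approximant 1 2 euler_amplitude (pade 1 2 euler_amplitude)"
    unfolding pade_def using is_pade_approximant_euler
    by (rule someI[where P = "is_pade_approximant 1 2 euler_amplitude"])
  have "fps_expansion (pade 1 2 euler_amplitude) 0 =
      1 / fps_of_poly euler_pade_den - fps_const (1/3) * (fps_X * (1 / fps_of_poly euler_pade_den))"
    unfolding is_pade_approximant_euler_fps[OF *] num
    by (simp add: fps_divide_unit algebra_simps)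
  then show ?thesis
    by (simp only: fps_sub_nth fps_mult_left_const_nth fps_X_mult_nth chebyshev_U_def flip: den)
       simp
qed

lemma higher_pderiv_monom_fact:
  "k \<le> n \<Longrightarrow> (pderiv ^^ k) (monom (1 :: 'a :: field_char_0) n) =
     monom (fact n / fact (n - k)) (n - k)"
proof (induction k)
  case (Suc k)
  then obtain m where "n = Suc (k + m)"
    using Suc.prems by (auto simp: Suc_le_eq dest: less_imp_Suc_add)
  with Suc show ?case
    by (simp add: pderiv_monom del: of_nat_Suc)
qed simp

lemma smult_sum_right: "smult c (sum f A) = (\<Sum>i\<in>A. smult c (f i))"
  by (induction A rule: infinite_finite_induct) (simp_all add: smult_add_right)

lemma umbral_trunc_exp_poly:
  "umbral \<phi> (trunc_exp_poly n) =
     (\<Sum>r\<le>n. monom (\<phi> r * (fact n / fact (n - r))) (n - r))"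
proof -
  have coeff: "coeff (trunc_exp_poly n) r =
      (if r \<le> n then monom (fact n / fact (n - r)) (n - r) else 0)" for r
    by (simp add: trunc_exp_poly_def coeff_sum sum.delta)
  \<comment> \<open>\<open>umbral\<close> sums up to the actual degree in the umbral variable; it is
    n because the leading coefficient is the nonzero constant n!.\<close>
  have "degree (trunc_exp_poly n) = n"
    by (intro antisym degree_le le_degree) (auto simp: coeff monom_eq_0_iff)
  then show ?thesis
    by (simp add: umbral_def coeff smult_monom)
qed

theorem theorem6:
  fixes n :: nat
  shows "pade_euler_poly 1 2 n =
           umbral (chebyshev_U (1/6) (1/12)) (trunc_exp_poly n)
           - smult (of_nat n / 3) (umbral (chebyshev_U (1/6) (1/12)) (trunc_exp_poly (n - 1)))"
proof -
  let ?U = "chebyshev_U (1/6) (1/12)"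
  let ?c = "\<lambda>k. fact n / fact (n - k) :: complex"
  let ?V = "\<lambda>k. if k = 0 then 0 else ?U (k - 1) / 3"
  have "pade_euler_poly 1 2 n = (\<Sum>k\<le>n. monom ((?U k - ?V k) * ?c k) (n - k))"
    unfolding pade_euler_poly_def diff_op_def
    by (intro sum.cong)
       (auto simp: degree_monom_eq higher_pderiv_monom_fact fps_expansion_pade_euler_nth
         smult_monom simp del: One_nat_def)
  also have "\<dots> = umbral ?U (trunc_exp_poly n) - (\<Sum>k\<le>n. monom (?V k * ?c k) (n - k))"
    unfolding umbral_trunc_exp_poly left_diff_distrib diff_monom[symmetric] sum_subtractf ..
  also have "(\<Sum>k\<le>n. monom (?V k * ?c k) (n - k)) =
      smult (of_nat n / 3) (umbral ?U (trunc_exp_poly (n - 1)))"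
  \<comment> \<open>For n = 0 both sides vanish: \<open>?V 0 = 0\<close> on the left, the factor
    \<open>of_nat n\<close> on the right, whatever the truncated \<open>n - 1\<close> means.\<close>
  proof (cases n)
    case (Suc m)
    show ?thesis
      \<comment> \<open>The summand at k = 0 vanishes. Substituting k = r + 1 leaves n!/(n-1-r)! = n
        (n-1)!/(n-1-r)!, whence the factor n/3.\<close>
      unfolding Suc sum.atMost_Suc_shift umbral_trunc_exp_poly
      by (simp add: smult_sum_right smult_monom mult_ac)
  qed simp
  finally show ?thesis .
qed

end
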